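(* Let $q,z\in\mathbb{C}$ with $|q|<1$ and $z\neq 0$. Then the sequences $$\alpha_n=z^{n}q^{\binom{n+1}{2}}\quad(n\in\mathbb{Z}),\qquad \beta_n=\frac{(-1/z)_{n+1}(-zq)_n}{(q)_{2n+1}}\quad(n\ge 0)$$ form an asymmetric bilateral Bailey pair with $a=1$ and $\lambda=1$; that is, for every integer $n\ge 0$, $$\beta_n=\sum_{k=-n-1}^{n}\frac{\alpha_k}{(q)_{n-k}(q)_{n+k+1}}.$$
   Context: For $n\ge 0$, $(a)_n=(a;q)_n=\prod_{j=1}^{n}(1-aq^{j-1})$, with $(a)_0=1$. For $m\in\mathbb{Z}$, $\binom{m}{2}=m(m-1)/2$. A pair of sequences $(\alpha_n)_{n\in\mathbb{Z}}$, $(\beta_n)_{n\ge 0}$ is an asymmetric bilateral Bailey pair with $a=1$, $\lambda=1$ if $\beta_n=\sum_{k=-n-1}^{n}\alpha_k/\big((q)_{n-k}(q)_{n+k+1}\big)$ for all $n\ge 0$. *)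

theory Defs
  imports Complex_Main
begin

definition qpoch :: "complex \<Rightarrow> complex \<Rightarrow> nat \<Rightarrow> complex" where
  "qpoch a q n = (\<Prod>j=1..n. 1 - a * q ^ (j - 1))"

(* m(m - 1) is always even and nonnegative, so the division is exact and the value is >= 0. *)
definition binom2 :: "int \<Rightarrow> int" where
  "binom2 m = m * (m - 1) div 2"

(* Asymmetric bilateral Bailey pair relative to the base q, for the parameters a = 1, lambda = 1.
   On the summation range -n - 1 <= k <= n both n - k and n + k + 1 are nonnegative,
   so the conversions by nat do not truncate. *)
definition asym_bilateral_bailey_pair ::
    "complex \<Rightarrow> (int \<Rightarrow> complex) \<Rightarrow> (nat \<Rightarrow> complex) \<Rightarrow> bool" where
  "asym_bilateral_bailey_pair q \<alpha> \<beta> \<longleftrightarrow>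
     (\<forall>n. \<beta> n = (\<Sum>k = - int n - 1..int n.
        \<alpha> k / (qpoch q q (nat (int n - k)) * qpoch q q (nat (int n + k + 1)))))"

end

theory Submission imports Defs begin

text \<open>
  The identity is the case m = n + 1 of the bilateral form of the finite q-binomial theorem,
  in which the product of (-1/z; q)_m and (-zq; q)_n equals the sum over k from -m to n of
  the q-binomial coefficient [m+n, m+k] times z^k q^(k(k+1)/2).
  The two q-Pascal rules correspond to the growth of the product by one factor on either side.
  Working with exponents that stay nonnegative makes the argument uniform in q, including q = 0.
\<close>

lemma qpoch_0 [simp]: "qpoch a q 0 = 1"
  by (simp add: qpoch_def)

lemma qpoch_Suc: "qpoch a q (Suc n) = qpoch a q n * (1 - a * q ^ n)"
  by (simp add: qpoch_def)

text \<open>Each factor is 1 - q^j with j \<ge> 1, and |q^j| < 1. All cancellation of denominators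
  below rests on this, and \<open>norm q < 1\<close> enters only through it.\<close>

lemma qpoch_self_nonzero:
  assumes "norm q < 1"
  shows "qpoch q q n \<noteq> 0"
proof (induction n)
  case (Suc n)
  have "norm (q ^ Suc n) < 1"
    using assms power_less_one_iff[of "norm q" "Suc n"] by (simp add: norm_power del: power_Suc)
  then have "1 - q * q ^ n \<noteq> 0" by auto
  with Suc show ?case by (simp add: qpoch_Suc)
qed simp

text \<open>An integer lower index with value 0 outside the range lets the Pascal rules hold at the
  boundary and lets sums be extended by vanishing terms.\<close>

definition qbinomial :: "complex \<Rightarrow> nat \<Rightarrow> int \<Rightarrow> complex" where
  "qbinomial q N j = (if 0 \<le> j \<and> j \<le> int N
     then qpoch q q N / (qpoch q q (nat j) * qpoch q q (nat (int N - j))) else 0)"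

lemma qbinomial_outside: "j < 0 \<or> int N < j \<Longrightarrow> qbinomial q N j = 0"
  by (auto simp: qbinomial_def)

lemma qbinomial_symmetric: "qbinomial q N (int N - j) = qbinomial q N j"
  by (auto simp: qbinomial_def mult.commute)

lemma qbinomial_add:
  "qbinomial q (a + b) (int a) = qpoch q q (a + b) / (qpoch q q a * qpoch q q b)"
  by (simp add: qbinomial_def)

lemma qbinomial_Suc:
  assumes q: "norm q < 1" and j: "j \<le> int N + 1"
  shows "qbinomial q (Suc N) j =
    qbinomial q N j + q ^ nat (int N + 1 - j) * qbinomial q N (j - 1)"
proof -
  consider "j < 0" | "j = 0" | "j = int N + 1" | "0 < j" "j \<le> int N" using j by linarith
  then show ?thesis
  proof cases
    case 1
    then show ?thesis by (simp add: qbinomial_outside)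
  next
    case 2
    then show ?thesis by (simp add: qbinomial_def qpoch_self_nonzero[OF q] nat_add_distrib)
  next
    case 3
    then show ?thesis by (simp add: qbinomial_def qpoch_self_nonzero[OF q] nat_add_distrib)
  next
    case 4
    define a b where "a = nat (j - 1)" and "b = nat (int N - j)"
    have j_eq: "j = int (Suc a)" and N_eq: "N = Suc (a + b)"
      using 4 by (auto simp: a_def b_def)
    note nz = qpoch_self_nonzero[OF q]
    have nz': "1 - q * q ^ a \<noteq> 0" "1 - q * q ^ b \<noteq> 0"
      using nz[of "Suc a"] nz[of "Suc b"] by (auto simp: qpoch_Suc)
    have top: "qbinomial q (Suc N) j =
        qpoch q q N * (1 - q * q ^ N) / (qpoch q q (Suc a) * qpoch q q (Suc b))"
      using qbinomial_add[of q "Suc a" "Suc b"] by (simp add: j_eq N_eq qpoch_Suc)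
    have left: "qbinomial q N j = qpoch q q N / (qpoch q q (Suc a) * qpoch q q b)"
      using qbinomial_add[of q "Suc a" b] by (simp add: j_eq N_eq)
    have right: "qbinomial q N (j - 1) = qpoch q q N / (qpoch q q a * qpoch q q (Suc b))"
      using qbinomial_add[of q a "Suc b"] by (simp add: j_eq N_eq)
    have expo: "nat (int N + 1 - j) = Suc b" by (simp add: j_eq N_eq)
    \<comment> \<open>The first summand cancels the last factor of \<open>qpoch q q (Suc b)\<close>
      and gives \<open>left\<close>; the second cancels that of \<open>qpoch q q (Suc a)\<close> and
      gives \<open>right\<close>.\<close>
    have split: "1 - q * q ^ N = (1 - q * q ^ b) + q ^ Suc b * (1 - q * q ^ a)"
      by (simp add: N_eq algebra_simps power_add)
    show ?thesis
      unfolding top left right expo split qpoch_Suc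
      using nz[of a] nz[of b] nz' by (simp add: divide_simps) (simp add: algebra_simps)
  qed
qed

text \<open>The reflection j \<mapsto> N + 1 - j turns the first Pascal rule into this one.\<close>

lemma qbinomial_Suc':
  assumes q: "norm q < 1" and j: "0 \<le> j"
  shows "qbinomial q (Suc N) j = qbinomial q N (j - 1) + q ^ nat j * qbinomial q N j"
proof -
  have "qbinomial q (Suc N) j = qbinomial q (Suc N) (int N + 1 - j)"
    using qbinomial_symmetric[of q "Suc N" j] by (simp add: add.commute)
  also have "\<dots> = qbinomial q N (int N + 1 - j) + q ^ nat j * qbinomial q N (int N - j)"
    using qbinomial_Suc[OF q, of "int N + 1 - j" N] j by (simp add: algebra_simps)
  also have "qbinomial q N (int N + 1 - j) = qbinomial q N (j - 1)"
    using qbinomial_symmetric[of q N "j - 1"] by (simp add: algebra_simps)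
  finally show ?thesis by (simp add: qbinomial_symmetric)
qed

lemma binom2_Suc: "binom2 (m + 1) = binom2 m + m"
proof -
  have "(m + 1) * (m + 1 - 1) = m * (m - 1) + m * 2" by (simp add: algebra_simps)
  then show ?thesis by (simp add: binom2_def)
qed

text \<open>Makes \<open>q powi binom2 m\<close> an ordinary power, with no inverse of q.\<close>

lemma binom2_nonneg: "0 \<le> binom2 m"
proof -
  have "0 \<le> m * (m - 1)"
    by (cases "m \<le> 0") (auto intro: mult_nonpos_nonpos)
  then show ?thesis by (simp add: binom2_def)
qed

definition theta_term :: "complex \<Rightarrow> complex \<Rightarrow> int \<Rightarrow> complex" where
  "theta_term q z k = z powi k * q powi binom2 (k + 1)"

text \<open>The factor q^a on the left absorbs a possibly negative k + 1, so that q = 0 is allowed.\<close>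

lemma theta_term_Suc:
  assumes z: "z \<noteq> 0" and b: "int b = int a + k + 1"
  shows "q ^ a * theta_term q z (k + 1) = z * q ^ b * theta_term q z k"
proof -
  have rec: "binom2 (k + 1 + 1) = binom2 (k + 1) + (k + 1)" by (rule binom2_Suc)
  have "a + nat (binom2 (k + 1 + 1)) = b + nat (binom2 (k + 1))"
    using b rec binom2_nonneg[of "k + 1"] binom2_nonneg[of "k + 1 + 1"] by linarith
  then have "q ^ a * q ^ nat (binom2 (k + 1 + 1)) = q ^ b * q ^ nat (binom2 (k + 1))"
    by (metis power_add)
  moreover have "q powi binom2 i = q ^ nat (binom2 i)" for i
    using binom2_nonneg[of i] by (simp add: power_int_def)
  moreover have "z powi (k + 1) = z * z powi k" using z by (simp add: power_int_add)
  ultimately show ?thesis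
    by (simp add: theta_term_def mult.assoc mult.left_commute)
qed

text \<open>A finite form of the theta series in the Jacobi triple product; the shift by m makes the
  lower index run through 0, ..., m + n.\<close>

definition bilateral_sum :: "complex \<Rightarrow> complex \<Rightarrow> nat \<Rightarrow> nat \<Rightarrow> complex" where
  "bilateral_sum q z m n =
     (\<Sum>k = - int m..int n. qbinomial q (m + n) (k + int m) * theta_term q z k)"

text \<open>The Pascal rule splits the sum in two. In the second part the recursion for
  \<open>theta_term\<close> trades the power of q depending on k for the constant z q^(n+1), leaving
  a shifted copy of the same sum.\<close>

lemma bilateral_sum_Suc_right:
  assumes q: "norm q < 1" and z: "z \<noteq> 0"
  shows "bilateral_sum q z m (Suc n) = bilateral_sum q z m n * (1 + z * q * q ^ n)"
proof -
  let ?g = "qbinomial q (m + n)" and ?t = "theta_term q z"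
  have summand: "qbinomial q (Suc (m + n)) (k + int m) * ?t k =
      ?g (k + int m) * ?t k + z * q * q ^ n * (?g (k - 1 + int m) * ?t (k - 1))"
    if "k \<in> {- int m..int n + 1}" for k
  proof -
    have "nat (int (m + n) + 1 - (k + int m)) = nat (int n + 1 - k)" by simp
    then have pascal: "qbinomial q (Suc (m + n)) (k + int m) =
        ?g (k + int m) + q ^ nat (int n + 1 - k) * ?g (k - 1 + int m)"
      using qbinomial_Suc[OF q, of "k + int m" "m + n"] that by (simp add: algebra_simps)
    have "q ^ nat (int n + 1 - k) * ?t k = z * q ^ Suc n * ?t (k - 1)"
      using theta_term_Suc[OF z, of "Suc n" "nat (int n + 1 - k)" "k - 1" q] that by simp
    then have "q ^ nat (int n + 1 - k) * ?t k * ?g (k - 1 + int m)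
        = z * q ^ Suc n * ?t (k - 1) * ?g (k - 1 + int m)"
      by (rule arg_cong)
    then show ?thesis unfolding pascal by (simp add: algebra_simps)
  qed
  \<comment> \<open>The extra index k = n + 1 has lower index m + n + 1, beyond the top.\<close>
  have same: "(\<Sum>k = - int m..int n + 1. ?g (k + int m) * ?t k) = bilateral_sum q z m n"
    unfolding bilateral_sum_def
    by (rule sum.mono_neutral_right) (auto intro: qbinomial_outside)
  \<comment> \<open>After the shift the extra index is k = -m - 1, with lower index -1.\<close>
  have "(\<Sum>k = - int m..int n + 1. ?g (k - 1 + int m) * ?t (k - 1)) =
      (\<Sum>k = - int m - 1..int n. ?g (k + int m) * ?t k)"
    by (rule sum.reindex_bij_witness[of _ "\<lambda>k. k + 1" "\<lambda>k. k - 1"]) auto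
  also have "\<dots> = bilateral_sum q z m n"
    unfolding bilateral_sum_def
    by (rule sum.mono_neutral_right) (auto intro: qbinomial_outside)
  finally have shifted: "(\<Sum>k = - int m..int n + 1. ?g (k - 1 + int m) * ?t (k - 1)) =
      bilateral_sum q z m n" .
  have "bilateral_sum q z m (Suc n) =
      (\<Sum>k = - int m..int n + 1. qbinomial q (Suc (m + n)) (k + int m) * ?t k)"
    by (simp add: bilateral_sum_def add.commute)
  also have "\<dots> = bilateral_sum q z m n + z * q * q ^ n * bilateral_sum q z m n"
    by (simp add: summand sum.distrib same flip: sum_distrib_left shifted)
  finally show ?thesis by (simp add: algebra_simps)
qed

text \<open>Mirror image of the previous growth step: the other Pascal rule is used, and the
  recursion for \<open>theta_term\<close> is read backwards, hence the division by z.\<close>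

lemma bilateral_sum_Suc_left:
  assumes q: "norm q < 1" and z: "z \<noteq> 0"
  shows "bilateral_sum q z (Suc m) n = bilateral_sum q z m n * (1 + q ^ m / z)"
proof -
  let ?g = "qbinomial q (m + n)" and ?t = "theta_term q z"
  have summand: "qbinomial q (Suc (m + n)) (k + int m + 1) * ?t k =
      ?g (k + int m) * ?t k + q ^ m / z * (?g (k + 1 + int m) * ?t (k + 1))"
    if "k \<in> {- int m - 1..int n}" for k
  proof -
    have pascal: "qbinomial q (Suc (m + n)) (k + int m + 1) =
        ?g (k + int m) + q ^ nat (k + int m + 1) * ?g (k + 1 + int m)"
      using qbinomial_Suc'[OF q, of "k + int m + 1" "m + n"] that by (simp add: algebra_simps)
    have "q ^ m * ?t (k + 1) = z * q ^ nat (k + int m + 1) * ?t k"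
      using theta_term_Suc[OF z, of "nat (k + int m + 1)" m k q] that by simp
    then have "q ^ nat (k + int m + 1) * ?t k = q ^ m / z * ?t (k + 1)"
      using z by (simp add: field_simps)
    then have "q ^ nat (k + int m + 1) * ?t k * ?g (k + 1 + int m)
        = q ^ m / z * ?t (k + 1) * ?g (k + 1 + int m)"
      by (rule arg_cong)
    then show ?thesis unfolding pascal by (simp add: algebra_simps)
  qed
  \<comment> \<open>Here the extra index is k = -m - 1, and after the shift below it is k = n + 1;
    both give a zero q-binomial.\<close>
  have same: "(\<Sum>k = - int m - 1..int n. ?g (k + int m) * ?t k) = bilateral_sum q z m n"
    unfolding bilateral_sum_def
    by (rule sum.mono_neutral_right) (auto intro: qbinomial_outside)
  have "(\<Sum>k = - int m - 1..int n. ?g (k + 1 + int m) * ?t (k + 1)) =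
      (\<Sum>k = - int m..int n + 1. ?g (k + int m) * ?t k)"
    by (rule sum.reindex_bij_witness[of _ "\<lambda>k. k - 1" "\<lambda>k. k + 1"]) auto
  also have "\<dots> = bilateral_sum q z m n"
    unfolding bilateral_sum_def
    by (rule sum.mono_neutral_right) (auto intro: qbinomial_outside)
  finally have shifted: "(\<Sum>k = - int m - 1..int n. ?g (k + 1 + int m) * ?t (k + 1)) =
      bilateral_sum q z m n" .
  have "bilateral_sum q z (Suc m) n =
      (\<Sum>k = - int m - 1..int n. qbinomial q (Suc (m + n)) (k + int m + 1) * ?t k)"
    by (simp add: bilateral_sum_def ac_simps minus_diff_commute)
  also have "\<dots> = bilateral_sum q z m n + q ^ m / z * bilateral_sum q z m n"
    by (simp only: summand sum.distrib same shifted flip: sum_distrib_left cong: sum.cong)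
  finally show ?thesis by (simp add: algebra_simps)
qed

text \<open>Starting from the single term 1 at m = n = 0, first n grows with m = 0, then m grows
  with n fixed. The growth factors are exactly the next factors of the two products.\<close>

lemma bilateral_qbinomial_theorem:
  assumes q: "norm q < 1" and z: "z \<noteq> 0"
  shows "bilateral_sum q z m n = qpoch (- 1 / z) q m * qpoch (- z * q) q n"
proof (induction m)
  case 0
  show ?case
  proof (induction n)
    case 0
    show ?case by (simp add: bilateral_sum_def qbinomial_def theta_term_def binom2_def)
  next
    case (Suc n)
    then show ?case by (simp add: bilateral_sum_Suc_right[OF q z] qpoch_Suc)
  qed
next
  case (Suc m)
  then show ?case by (simp add: bilateral_sum_Suc_left[OF q z] qpoch_Suc)
qed

theorem lemma3p1:
  fixes q z :: complex
  assumes "norm q < 1" and "z \<noteq> 0"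
  shows "asym_bilateral_bailey_pair q
           (\<lambda>n. z powi n * q powi binom2 (n + 1))
           (\<lambda>n. qpoch (- 1 / z) q (n + 1) * qpoch (- z * q) q n / qpoch q q (2 * n + 1))"
  unfolding asym_bilateral_bailey_pair_def
proof
  fix n
  have "qpoch (- 1 / z) q (n + 1) * qpoch (- z * q) q n = bilateral_sum q z (n + 1) n"
    by (rule bilateral_qbinomial_theorem[OF assms, symmetric])
  also have "\<dots> / qpoch q q (2 * n + 1) = (\<Sum>k = - int n - 1..int n.
      qbinomial q (2 * n + 1) (k + int n + 1) * theta_term q z k / qpoch q q (2 * n + 1))"
  proof -
    have "n + 1 + n = 2 * n + 1" "- int (n + 1) = - int n - 1" by simp_all
    moreover have "k + int (n + 1) = k + int n + 1" for k by simp
    ultimately show ?thesis unfolding bilateral_sum_def sum_divide_distrib by presburger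
  qed
  also have "\<dots> = (\<Sum>k = - int n - 1..int n. z powi k * q powi binom2 (k + 1) /
      (qpoch q q (nat (int n - k)) * qpoch q q (nat (int n + k + 1))))"
  proof (rule sum.cong)
    fix k assume k: "k \<in> {- int n - 1..int n}"
    \<comment> \<open>The complementary lower index is n - k, so dividing the q-binomial by
      (q)_{2n+1} leaves precisely the kernel of the Bailey pair.\<close>
    have "int (2 * n + 1) - (k + int n + 1) = int n - k" by simp
    then have "qbinomial q (2 * n + 1) (k + int n + 1) = qpoch q q (2 * n + 1) /
        (qpoch q q (nat (int n + k + 1)) * qpoch q q (nat (int n - k)))"
      using k by (simp add: qbinomial_def add.commute)
    then show "qbinomial q (2 * n + 1) (k + int n + 1) * theta_term q z k / qpoch q q (2 * n + 1) =
        z powi k * q powi binom2 (k + 1) /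
        (qpoch q q (nat (int n - k)) * qpoch q q (nat (int n + k + 1)))"
      using qpoch_self_nonzero[OF assms(1), of "2 * n + 1"]
      by (simp add: theta_term_def mult.commute)
  qed simp
  finally show "qpoch (- 1 / z) q (n + 1) * qpoch (- z * q) q n / qpoch q q (2 * n + 1) =
      (\<Sum>k = - int n - 1..int n. z powi k * q powi binom2 (k + 1) /
        (qpoch q q (nat (int n - k)) * qpoch q q (nat (int n + k + 1))))" .
qed

end
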